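(* For every graph $G$ of order $n$, $\Gamma(G)+\chi(\overline{G})\le n+1$, and this bound is sharp (that is, there exist graphs $G$ for which equality holds).
   Context: All graphs are finite and simple, with at least one vertex. The order of $G$ is its number of vertices. $\overline{G}$ is the complement of $G$, and $\chi$ denotes the chromatic number. A Grundy $k$-coloring of $G$ is a partition of $V(G)$ into $k$ nonempty independent sets $V_1,\dots,V_k$ such that for every $i$, every vertex $v\in V_i$ has at least one neighbor in each $V_j$ with $j<i$. The Grundy number $\Gamma(G)$ is the largest $k$ for which $G$ has a Grundy $k$-coloring. *)

theory Defs
  imports "Graph_Theory.Pair_Digraph" "HOL-Library.Disjoint_Sets" "HOL-Library.FuncSet"
begin

text \<open>
  The locale predicate \<open>pair_graph\<close> describes finite simple graphs: the vertex and arc sets are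
  finite, the arc relation is symmetric and loop-free, and an undirected edge is the pair of its
  two arcs. It admits the graph without vertices, which is excluded here.
\<close>

definition fin_simple_graph :: "'a pair_pre_digraph \<Rightarrow> bool" where
  "fin_simple_graph G \<longleftrightarrow> pair_graph G \<and> pverts G \<noteq> {}"

definition graph_order :: "'a pair_pre_digraph \<Rightarrow> nat" where
  "graph_order G = card (pverts G)"

definition graph_complement :: "'a pair_pre_digraph \<Rightarrow> 'a pair_pre_digraph" where
  "graph_complement G =
     \<lparr> pverts = pverts G,
       parcs = {(u, v). u \<in> pverts G \<and> v \<in> pverts G \<and> u \<noteq> v \<and> (u, v) \<notin> parcs G} \<rparr>"

definition independent_set :: "'a pair_pre_digraph \<Rightarrow> 'a set \<Rightarrow> bool" where
  "independent_set G S \<longleftrightarrow> S \<subseteq> pverts G \<and> (\<forall>u\<in>S. \<forall>v\<in>S. (u, v) \<notin> parcs G)"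

definition proper_coloring :: "'a pair_pre_digraph \<Rightarrow> nat \<Rightarrow> ('a \<Rightarrow> nat) \<Rightarrow> bool" where
  "proper_coloring G k c \<longleftrightarrow>
     c \<in> pverts G \<rightarrow> {..<k} \<and> (\<forall>(u, v)\<in>parcs G. c u \<noteq> c v)"

definition chromatic_number :: "'a pair_pre_digraph \<Rightarrow> nat" where
  "chromatic_number G = (LEAST k. \<exists>c. proper_coloring G k c)"

text \<open>The colour classes are \<open>V 1, \<dots>, V k\<close>; the values of \<open>V\<close> at other indices are irrelevant.\<close>

definition grundy_coloring :: "'a pair_pre_digraph \<Rightarrow> nat \<Rightarrow> (nat \<Rightarrow> 'a set) \<Rightarrow> bool" where
  "grundy_coloring G k V \<longleftrightarrow>
     (\<Union>i\<in>{1..k}. V i) = pverts G \<and>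
     disjoint_family_on V {1..k} \<and>
     (\<forall>i\<in>{1..k}. V i \<noteq> {} \<and> independent_set G (V i)) \<and>
     (\<forall>i\<in>{1..k}. \<forall>v\<in>V i. \<forall>j\<in>{1..<i}. \<exists>u\<in>V j. (v, u) \<in> parcs G)"

definition grundy_number :: "'a pair_pre_digraph \<Rightarrow> nat" where
  "grundy_number G = Max {k. \<exists>V. grundy_coloring G k V}"

lemma fin_simple_graph_complement:
  assumes "fin_simple_graph G"
  shows "fin_simple_graph (graph_complement G)"
proof -
  interpret pair_graph G using assms by (simp add: fin_simple_graph_def)
  have flip: "(v, u) \<in> parcs G" if "(u, v) \<in> parcs G" for u v
    using pair_sym_arcs that unfolding symmetric_def with_proj_simps by (rule symD)
  have "finite (parcs (graph_complement G))"
    by (rule finite_subset[of _ "pverts G \<times> pverts G"])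
       (auto simp: graph_complement_def pair_finite_verts)
  moreover have "symmetric (graph_complement G)"
    unfolding symmetric_def with_proj_simps
    by (rule symI) (auto simp: graph_complement_def dest: flip)
  ultimately have "pair_graph (graph_complement G)"
    by unfold_locales (auto simp: graph_complement_def pair_finite_verts)
  then show ?thesis
    using assms by (simp add: fin_simple_graph_def graph_complement_def)
qed

text \<open>The maximum defining the Grundy number ranges over a finite set.\<close>

lemma grundy_coloring_le_order:
  assumes "fin_simple_graph G" "grundy_coloring G k V"
  shows "k \<le> graph_order G"
proof -
  have fin: "finite (pverts G)"
    using assms(1) by (simp add: fin_simple_graph_def pair_graph_def pair_digraph_def
      pair_fin_digraph.pair_finite_verts)
  define f where "f i = (SOME v. v \<in> V i)" for i
  have f: "f i \<in> V i" if "i \<in> {1..k}" for i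
    using assms(2) that unfolding f_def grundy_coloring_def by (simp add: some_in_eq)
  have "inj_on f {1..k}"
  proof (rule inj_onI, rule ccontr)
    fix i j assume ij: "i \<in> {1..k}" "j \<in> {1..k}" "f i = f j" "i \<noteq> j"
    have "V i \<inter> V j = {}"
      using assms(2) ij by (simp add: grundy_coloring_def disjoint_family_on_def)
    then show False using f[OF ij(1)] f[OF ij(2)] ij(3) by (simp add: disjoint_iff)
  qed
  moreover have "f ` {1..k} \<subseteq> pverts G"
  proof -
    have "pverts G = (\<Union>i\<in>{1..k}. V i)" using assms(2) by (simp add: grundy_coloring_def)
    then show ?thesis using f by (simp only: image_subset_iff UN_iff) (intro ballI bexI)
  qed
  ultimately have "card {1..k} \<le> card (pverts G)"
    using fin by (rule card_inj_on_le)
  then show ?thesis by (simp add: graph_order_def)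
qed

end

theory Submission
  imports Defs
begin

text \<open>
  A colouring of the complement of \<open>G\<close> is a partition of the vertices of \<open>G\<close> into cliques, so the
  inequality asks for a clique partition with at most \<open>n + 1 - k\<close> parts whenever \<open>G\<close> has a Grundy
  colouring with \<open>k\<close> classes. The proof in \<open>clique_partition_of_grundy_classes\<close> is an induction on
  \<open>k\<close>. Take a vertex \<open>u\<close> in the top class. The remaining vertices still contain the \<open>k - 1\<close> lower
  classes, so by induction they split into \<open>m \<le> n - (k - 1)\<close> cliques. If \<open>m \<le> n - k\<close>, the singleton
  \<open>{u}\<close> can be afforded as a new clique. Otherwise \<open>m = n - k + 1\<close>; since \<open>u\<close> has a neighbour in each
  of the \<open>k - 1\<close> lower classes, it has at most \<open>(n - 1) - (k - 1) < m\<close> non-neighbours, so one of the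
  \<open>m\<close> cliques consists of neighbours of \<open>u\<close> only and \<open>u\<close> joins it.

  The induction has to be stated for lower classes that need not exhaust the vertex set, because
  deleting \<open>u\<close> leaves the other vertices of its class behind.

  The Grundy number is a maximum, so the bound for each single colouring transfers to it once some
  Grundy colouring is known to exist; first-fit colouring provides one. Equality holds for the graph
  with one vertex.
\<close>

section \<open>Clique partitions from Grundy classes\<close>

text \<open>Disjointness makes neighbours chosen in different classes distinct.\<close>

lemma neighbours_in_grundy_classes:
  assumes disj: "disjoint_family_on V J" and fin: "finite T" "finite J"
    and V: "\<And>j. j \<in> J \<Longrightarrow> V j \<subseteq> T"
    and nbr: "\<And>j. j \<in> J \<Longrightarrow> \<exists>w\<in>V j. (u, w) \<in> A"
  shows "card J \<le> card {w \<in> T. (u, w) \<in> A}"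
proof -
  from nbr have "\<forall>j. \<exists>w. j \<in> J \<longrightarrow> w \<in> V j \<and> (u, w) \<in> A" by blast
  then obtain f where f: "\<And>j. j \<in> J \<Longrightarrow> f j \<in> V j \<and> (u, f j) \<in> A" by metis
  have "inj_on f J"
    using f disj unfolding inj_on_def disjoint_family_on_def by (metis disjoint_iff)
  moreover have "f ` J \<subseteq> {w \<in> T. (u, w) \<in> A}" using f V by blast
  ultimately show ?thesis using fin by (intro card_inj_on_le) auto
qed

text \<open>
  Deleting a vertex of the top class lowers both \<open>k\<close> and \<open>card S\<close> by one, so a bound on
  \<open>m + k\<close> leaves room for the vertex as a new part unless the induction hypothesis is tight. The
  parts are the fibres of \<open>c\<close>, some of which may be empty; an empty fibre can also receive the
  vertex, so counting non-neighbours against \<open>m\<close> is still enough.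
\<close>

lemma clique_partition_of_grundy_classes:
  assumes "sym A" "finite S"
    and "disjoint_family_on V {1..k}"
    and "\<And>i. i \<in> {1..k} \<Longrightarrow> V i \<noteq> {} \<and> V i \<subseteq> S"
    and "\<And>i v j. i \<in> {1..k} \<Longrightarrow> v \<in> V i \<Longrightarrow> j \<in> {1..<i} \<Longrightarrow> \<exists>u\<in>V j. (v, u) \<in> A"
  shows "\<exists>m c. m + k \<le> card S + 1 \<and> c \<in> S \<rightarrow> {..<m} \<and>
           (\<forall>u\<in>S. \<forall>v\<in>S. u \<noteq> v \<and> c u = c v \<longrightarrow> (u, v) \<in> A)"
  using assms(2-)
proof (induction k arbitrary: S)
  case 0
  obtain c where "bij_betw c S {0..<card S}"
    using ex_bij_betw_finite_nat[OF "0.prems"(1)] by blast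
  then show ?case
    by (intro exI[of _ "card S"] exI[of _ c])
       (auto simp: bij_betw_def inj_on_def)
next
  case (Suc k)
  obtain u where u: "u \<in> V (Suc k)" using Suc.prems(3)[of "Suc k"] by auto
  have uS: "u \<in> S" using u Suc.prems(3)[of "Suc k"] by auto
  let ?T = "S - {u}"
  have finT: "finite ?T" using Suc.prems(1) by simp
  have cardT: "Suc (card ?T) = card S" using uS Suc.prems(1) by (metis card_Suc_Diff1)
  have disj: "disjoint_family_on V {1..k}"
    using Suc.prems(2) by (rule disjoint_family_on_mono[rotated]) auto
  have VT: "V i \<noteq> {} \<and> V i \<subseteq> ?T" if "i \<in> {1..k}" for i
  proof -
    have "V i \<inter> V (Suc k) = {}"
      using Suc.prems(2) that by (intro disjoint_family_onD) auto
    then show ?thesis using Suc.prems(3)[of i] u that by auto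
  qed
  have "\<exists>w\<in>V j. (v, w) \<in> A" if "i \<in> {1..k}" "v \<in> V i" "j \<in> {1..<i}" for i v j
    using Suc.prems(4)[of i v j] that by auto
  then obtain m c where mk: "m + k \<le> card ?T + 1" and c: "c \<in> ?T \<rightarrow> {..<m}"
    and cl: "\<And>v w. v \<in> ?T \<Longrightarrow> w \<in> ?T \<Longrightarrow> v \<noteq> w \<Longrightarrow> c v = c w \<Longrightarrow> (v, w) \<in> A"
    using Suc.IH[OF finT disj VT] by blast
  \<comment> \<open>Either one more part fits into the bound, or the parts outnumber the non-neighbours of \<open>u\<close>.\<close>
  show ?case
  proof (cases "m + k \<le> card ?T")
    case True
    have "c w \<noteq> m" if "w \<in> ?T" for w using c that by auto
    then have "(v, w) \<in> A" if "v \<in> S" "w \<in> S" "v \<noteq> w" "(c(u := m)) v = (c(u := m)) w" for v w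
      using that cl[of v w] by (auto split: if_splits)
    moreover have "c(u := m) \<in> S \<rightarrow> {..<Suc m}" using c by (auto simp: Pi_iff less_Suc_eq)
    moreover have "Suc m + Suc k \<le> card S + 1" using True cardT by simp
    ultimately show ?thesis by blast
  next
    case False
    let ?N = "{w \<in> ?T. (u, w) \<in> A}" and ?M = "{w \<in> ?T. (u, w) \<notin> A}"
    have "card {1..k} \<le> card ?N"
      using disj finT VT Suc.prems(4)[of "Suc k" u] u
      by (intro neighbours_in_grundy_classes[where V = V]) auto
    moreover have "card ?N + card ?M = card ?T"
    proof -
      have "card (?N \<union> ?M) = card ?N + card ?M"
        using finT by (intro card_Un_disjoint) auto
      moreover have "?N \<union> ?M = ?T" by auto
      ultimately show ?thesis by simp
    qed
    ultimately have "card ?M < m" using False by simp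
    then have "card (c ` ?M) < card {..<m}"
      using card_image_le[of ?M c] finT by simp
    then have "\<not> {..<m} \<subseteq> c ` ?M"
      using card_mono[of "c ` ?M" "{..<m}"] finT by auto
    then obtain i where i: "i < m" "i \<notin> c ` ?M" by auto
    have nb: "(u, w) \<in> A" "(w, u) \<in> A" if "w \<in> ?T" "c w = i" for w
      using i(2) that symD[OF assms(1)] by auto
    have "(v, w) \<in> A" if "v \<in> S" "w \<in> S" "v \<noteq> w" "(c(u := i)) v = (c(u := i)) w" for v w
      using that cl[of v w] nb[of v] nb[of w] by (auto split: if_splits)
    moreover have "c(u := i) \<in> S \<rightarrow> {..<m}" using c i(1) by (auto simp: Pi_iff)
    moreover have "m + Suc k \<le> card S + 1" using mk cardT by simp
    ultimately show ?thesis by blast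
  qed
qed

lemma grundy_coloring_add_chromatic_complement_le:
  assumes G: "fin_simple_graph G" and V: "grundy_coloring G k V"
  shows "k + chromatic_number (graph_complement G) \<le> graph_order G + 1"
proof -
  interpret pair_graph G using G by (simp add: fin_simple_graph_def)
  have sym: "sym (parcs G)" using pair_sym_arcs unfolding symmetric_def with_proj_simps .
  have disj: "disjoint_family_on V {1..k}"
    using V by (simp add: grundy_coloring_def)
  have sub: "V i \<noteq> {} \<and> V i \<subseteq> pverts G" if "i \<in> {1..k}" for i
    using V that by (auto simp: grundy_coloring_def independent_set_def)
  have nbr: "\<exists>u\<in>V j. (v, u) \<in> parcs G" if "i \<in> {1..k}" "v \<in> V i" "j \<in> {1..<i}" for i v j
    using V that unfolding grundy_coloring_def by blast
  have "\<exists>m c. m + k \<le> card (pverts G) + 1 \<and> c \<in> pverts G \<rightarrow> {..<m} \<and>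
      (\<forall>u\<in>pverts G. \<forall>v\<in>pverts G. u \<noteq> v \<and> c u = c v \<longrightarrow> (u, v) \<in> parcs G)"
    using sym pair_finite_verts disj sub nbr by (rule clique_partition_of_grundy_classes)
  then obtain m c where mk: "m + k \<le> card (pverts G) + 1" and c: "c \<in> pverts G \<rightarrow> {..<m}"
    and cl: "\<forall>u\<in>pverts G. \<forall>v\<in>pverts G. u \<noteq> v \<and> c u = c v \<longrightarrow> (u, v) \<in> parcs G"
    by blast
  have "proper_coloring (graph_complement G) m c"
    using c cl by (auto simp: proper_coloring_def graph_complement_def)
  then have "chromatic_number (graph_complement G) \<le> m"
    unfolding chromatic_number_def by (blast intro: Least_le)
  then show ?thesis using mk by (simp add: graph_order_def)
qed

section \<open>The Grundy number is attained\<close>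

text \<open>
  First-fit: a new vertex receives the least colour that none of its coloured neighbours has. By
  minimality it sees every smaller colour, and vertices coloured earlier keep their witnesses.
\<close>

lemma first_fit_coloring_exists:
  assumes "finite S" "sym A" "irrefl A"
  shows "\<exists>c :: 'a \<Rightarrow> nat. (\<forall>u\<in>S. \<forall>v\<in>S. (u, v) \<in> A \<longrightarrow> c u \<noteq> c v) \<and>
           (\<forall>v\<in>S. \<forall>j<c v. \<exists>u\<in>S. c u = j \<and> (v, u) \<in> A)"
  using assms(1)
proof (induction S)
  case empty
  then show ?case by simp
next
  case (insert x S)
  then obtain c :: "'a \<Rightarrow> nat"
    where proper: "\<And>u v. u \<in> S \<Longrightarrow> v \<in> S \<Longrightarrow> (u, v) \<in> A \<Longrightarrow> c u \<noteq> c v"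
      and low: "\<And>v j. v \<in> S \<Longrightarrow> j < c v \<Longrightarrow> \<exists>u\<in>S. c u = j \<and> (v, u) \<in> A"
    by blast
  define P where "P j \<longleftrightarrow> (\<forall>u\<in>S. (x, u) \<in> A \<longrightarrow> c u \<noteq> j)" for j
  obtain j where "j \<notin> c ` S"
    using ex_new_if_finite[OF infinite_UNIV_nat] insert.hyps(1) by blast
  then have "P j" unfolding P_def by blast
  then have PL: "P (Least P)" by (rule LeastI)
  have below: "\<exists>u\<in>S. c u = i \<and> (x, u) \<in> A" if "i < Least P" for i
    using not_less_Least[OF that] unfolding P_def by blast
  have xx: "(x, x) \<notin> A" using assms(3) by (simp add: irrefl_def)
  let ?c = "c(x := Least P)"
  have old: "?c u = c u" if "u \<in> S" for u using that insert.hyps(2) by auto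
  have new: "c u \<noteq> Least P" if "u \<in> S" "(x, u) \<in> A" for u
    using PL that unfolding P_def by blast
  have "?c u \<noteq> ?c v" if "u \<in> insert x S" "v \<in> insert x S" "(u, v) \<in> A" for u v
    using that proper[of u v] new[of u] new[of v] xx symD[OF assms(2) that(3)] by auto
  moreover have "\<exists>u\<in>insert x S. ?c u = i \<and> (v, u) \<in> A"
    if v: "v \<in> insert x S" and i: "i < ?c v" for v i
  proof -
    have "\<exists>u\<in>S. c u = i \<and> (v, u) \<in> A"
      using v i low below by (cases "v = x") auto
    then show ?thesis using old by (metis insertCI)
  qed
  ultimately show ?case by blast
qed

lemma grundy_coloring_exists:
  assumes G: "fin_simple_graph G"
  shows "\<exists>k V. grundy_coloring G k V"
proof -
  interpret pair_graph G using G by (simp add: fin_simple_graph_def)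
  let ?S = "pverts G"
  have ne: "?S \<noteq> {}" using G by (simp add: fin_simple_graph_def)
  have "sym (parcs G)" using pair_sym_arcs unfolding symmetric_def with_proj_simps .
  moreover have "irrefl (parcs G)" using pair_no_loops by (fastforce simp: irrefl_def)
  ultimately obtain c :: "'a \<Rightarrow> nat"
    where proper: "\<And>u v. u \<in> ?S \<Longrightarrow> v \<in> ?S \<Longrightarrow> (u, v) \<in> parcs G \<Longrightarrow> c u \<noteq> c v"
      and low: "\<And>v j. v \<in> ?S \<Longrightarrow> j < c v \<Longrightarrow> \<exists>u\<in>?S. c u = j \<and> (v, u) \<in> parcs G"
    using first_fit_coloring_exists[OF pair_finite_verts] by metis
  define k where "k = Suc (Max (c ` ?S))"
  define V where "V i = {v \<in> ?S. Suc (c v) = i}" for i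
  have ck: "Suc (c v) \<le> k" if "v \<in> ?S" for v
    unfolding k_def using that pair_finite_verts by simp
  have "Max (c ` ?S) \<in> c ` ?S" using ne pair_finite_verts by (intro Max_in) auto
  then obtain t where t: "t \<in> ?S" "Suc (c t) = k" unfolding k_def by auto
  \<comment> \<open>No colour below the largest is skipped: a vertex of the largest colour sees all of them.\<close>
  have nonempty: "V i \<noteq> {}" if "i \<in> {1..k}" for i
  proof (cases "i = k")
    case True
    then show ?thesis using t by (auto simp: V_def)
  next
    case False
    then have "i - 1 < c t" using that t(2) by auto
    from low[OF t(1) this] obtain u where "u \<in> ?S" "c u = i - 1" by blast
    then show ?thesis using that by (auto simp: V_def)
  qed
  have sees: "\<exists>u\<in>V j. (v, u) \<in> parcs G" if "v \<in> V i" "j \<in> {1..<i}" for v i j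
  proof -
    from that have v: "v \<in> ?S" and "j - 1 < c v" by (auto simp: V_def)
    from low[OF this] obtain u where "u \<in> ?S" "c u = j - 1" "(v, u) \<in> parcs G" by blast
    then show ?thesis using that by (auto simp: V_def)
  qed
  have "(\<Union>i\<in>{1..k}. V i) = ?S" using ck by (auto simp: V_def)
  moreover have "disjoint_family_on V {1..k}"
    by (auto simp: disjoint_family_on_def V_def)
  moreover have "independent_set G (V i)" for i
    using proper by (fastforce simp: independent_set_def V_def)
  ultimately have "grundy_coloring G k V"
    using nonempty sees unfolding grundy_coloring_def by blast
  then show ?thesis by blast
qed

lemma grundy_number_attained:
  assumes G: "fin_simple_graph G"
  shows "\<exists>V. grundy_coloring G (grundy_number G) V"
proof -
  let ?K = "{k. \<exists>V. grundy_coloring G k V}"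
  have "?K \<subseteq> {..graph_order G}" using grundy_coloring_le_order[OF G] by blast
  then have "finite ?K" by (rule finite_subset) simp
  moreover have "?K \<noteq> {}" using grundy_coloring_exists[OF G] by blast
  ultimately have "Max ?K \<in> ?K" by (rule Max_in)
  then show ?thesis by (simp add: grundy_number_def)
qed

section \<open>The bound and its sharpness\<close>

lemma grundy_number_add_chromatic_complement_le:
  assumes "fin_simple_graph G"
  shows "grundy_number G + chromatic_number (graph_complement G) \<le> graph_order G + 1"
proof -
  obtain V where "grundy_coloring G (grundy_number G) V"
    using grundy_number_attained[OF assms] by blast
  then show ?thesis by (rule grundy_coloring_add_chromatic_complement_le[OF assms])
qed

lemma grundy_number_pos:
  assumes "fin_simple_graph G"
  shows "grundy_number G > 0"
proof -
  obtain V where "grundy_coloring G (grundy_number G) V"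
    using grundy_number_attained[OF assms] by blast
  then have "(\<Union>i\<in>{1..grundy_number G}. V i) = pverts G" by (simp add: grundy_coloring_def)
  moreover have "pverts G \<noteq> {}" using assms by (simp add: fin_simple_graph_def)
  ultimately show ?thesis by (cases "grundy_number G") auto
qed

text \<open>
  A colouring with pairwise distinct colours exists, so the least number of colours is attained by
  some colouring; with no colours at all a vertex cannot be coloured.
\<close>

lemma chromatic_number_pos:
  assumes G: "fin_simple_graph G"
  shows "chromatic_number G > 0"
proof -
  interpret pair_graph G using G by (simp add: fin_simple_graph_def)
  obtain c where c: "bij_betw c (pverts G) {0..<card (pverts G)}"
    using ex_bij_betw_finite_nat[OF pair_finite_verts] by blast
  have "proper_coloring G (card (pverts G)) c"
    unfolding proper_coloring_def
  proof (intro conjI ballI)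
    show "c \<in> pverts G \<rightarrow> {..<card (pverts G)}" using c by (auto simp: bij_betw_def)
    show "case e of (u, v) \<Rightarrow> c u \<noteq> c v" if "e \<in> parcs G" for e
    proof -
      have "fst e \<in> pverts G" "snd e \<in> pverts G" "fst e \<noteq> snd e"
        using that by (rule arc_fst_in_verts arc_snd_in_verts pair_no_loops)+
      then show ?thesis
        using bij_betw_imp_inj_on[OF c] by (auto simp: inj_on_def split: prod.split)
    qed
  qed
  then have "\<exists>k c. proper_coloring G k c" by blast
  then have "\<exists>c. proper_coloring G (chromatic_number G) c"
    unfolding chromatic_number_def by (rule LeastI_ex)
  then obtain d where "d \<in> pverts G \<rightarrow> {..<chromatic_number G}"
    by (auto simp: proper_coloring_def)
  moreover have "pverts G \<noteq> {}" using G by (simp add: fin_simple_graph_def)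
  ultimately show ?thesis by (cases "chromatic_number G") auto
qed

theorem theorem3p2:
  shows "(\<forall>(G :: 'a pair_pre_digraph) n. fin_simple_graph G \<and> graph_order G = n \<longrightarrow>
            grundy_number G + chromatic_number (graph_complement G) \<le> n + 1) \<and>
         (\<exists>(G :: nat pair_pre_digraph) n. fin_simple_graph G \<and> graph_order G = n \<and>
            grundy_number G + chromatic_number (graph_complement G) = n + 1)"
proof (intro conjI)
  show "\<forall>(G :: 'a pair_pre_digraph) n. fin_simple_graph G \<and> graph_order G = n \<longrightarrow>
      grundy_number G + chromatic_number (graph_complement G) \<le> n + 1"
    using grundy_number_add_chromatic_complement_le by blast
next
  \<comment> \<open>On one vertex both summands are at least \<open>1\<close>, and the bound gives the converse.\<close>
  define K :: "nat pair_pre_digraph" where "K = \<lparr> pverts = {0}, parcs = {} \<rparr>"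
  have "pair_graph K"
    by unfold_locales (auto simp: K_def symmetric_def arcs_ends_def sym_def)
  then have K: "fin_simple_graph K" by (simp add: fin_simple_graph_def K_def)
  have "graph_order K = 1" by (simp add: graph_order_def K_def)
  moreover have "grundy_number K + chromatic_number (graph_complement K) = 1 + 1"
    using grundy_number_add_chromatic_complement_le[OF K] grundy_number_pos[OF K]
      chromatic_number_pos[OF fin_simple_graph_complement[OF K]] calculation by linarith
  ultimately show "\<exists>(G :: nat pair_pre_digraph) n. fin_simple_graph G \<and> graph_order G = n \<and>
      grundy_number G + chromatic_number (graph_complement G) = n + 1"
    using K by blast
qed

end
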